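(* Consider the quantized closed-loop system $$\dot x = F(x,\mu)+G(x,\mu)\zeta,\qquad \dot\zeta = q(x,\zeta,\mu)-b(x,\zeta,\mu)\,\Psi(\bar k\zeta),$$ where $\dot x=F(x,\mu)$ satisfies the Uniform Lyapunov Property with data $(\mathcal A,c,V)$, let $d\ge 1$ and let $\sigma>0$ be arbitrary. For any $\delta\in(0,1)$, there exist positive numbers $k^\ast$, $j^\ast$ and $u_0$ such that, for any gain $\bar k\ge k^\ast$ and any number of quantization levels $j\ge j^\ast$, any Krasowskii solution $\varphi$ of the closed-loop system (with $\Psi$ the logarithmic quantizer with parameters $u_0,j,\delta$, and $\mu\in\mathcal P$) is such that, if $\varphi(0)\in\Omega_{c^2+d^2+1}$, then there exists $T>0$ such that $\varphi(t)\in\Omega_\sigma$ for all $t\ge T$.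
   Context: Setting: $x\in\mathbb R^{n-1}$, $\zeta\in\mathbb R$; $\mu$ is an unknown parameter ranging over a compact set $\mathcal P$; $F,G,q,b$ are continuous functions of their arguments, and there is $b_0>0$ with $b(x,\zeta,\mu)\ge b_0$ for all $(x,\zeta,\mu)$. The open-loop system is $\dot x=F(x,\mu)+G(x,\mu)\zeta$, $\dot\zeta=q(x,\zeta,\mu)+b(x,\zeta,\mu)u$, and the feedback is $u=-\Psi(\bar k\zeta)$. Uniform Lyapunov Property: there exist an open set $\mathcal A\subset\mathbb R^{n-1}$, a real number $c\ge1$ and a continuously differentiable positive definite function $V:\mathcal A\to\mathbb R_+$ such that $\Gamma_{c+1}:=\{x: V(x)\le c+1\}\subset\mathcal A$ and $\frac{\partial V}{\partial x}F(x,\mu)<0$ for all $x\in\Gamma_{c+1}$, $x\neq0$, and all $\mu\in\mathcal P$. Lyapunov function and sets: for $d\ge1$, $$W(x,\zeta)=\frac{cV(x)}{c+1-V(x)}+\frac{d\zeta^2}{d+1-\zeta^2}$$ on $\{x:V(x)<c+1\}\times\{\zeta:\zeta^2<d+1\}$, where $W$ is positive definite and proper (its sublevel sets are compact). For $\ell>0$, $\Omega_\ell=\{(x,\zeta): W(x,\zeta)\le \ell\}$. Logarithmic quantizer with parameters $u_0>0$, $j\in\mathbb N$, $\delta\in(0,1)$: put $\rho=\frac{1-\delta}{1+\delta}$ and $u_i=\rho^iu_0$. Then $\Psi(r)=u_i$ if $\frac{u_i}{1+\delta}<r\le\frac{u_i}{1-\delta}$, $0\le i\le j$; $\Psi(r)=0$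 if $0\le r\le \frac{u_j}{1+\delta}$; $\Psi(r)=-\Psi(-r)$ if $r<0$. The quantizer is not defined for $|r|>\frac{u_0}{1-\delta}$, the number $u_0$ being designed in such a way that this bound is never exceeded by $\bar k\zeta$. Krasowskii solution of $\dot y=H(t,y)$ (with $H:[0,+\infty)\times\mathbb R^n\to\mathbb R^n$ possibly discontinuous): an absolutely continuous curve $\varphi:[0,+\infty)\to\mathbb R^n$ satisfying, for almost every $t\ge0$, $\dot\varphi(t)\in K(H(t,\varphi(t)))$, where $K(H(t,y))=\bigcap_{\epsilon>0}\overline{\mathrm{co}}\,H(t,B_\epsilon(y))$, with $B_\epsilon(y)$ the ball of radius $\epsilon$ about $y$ and $\overline{\mathrm{co}}$ the closed convex hull.
   Formalization: The number u0 is allowed to depend on the gain k̄ (k* and j* are not), because no single u0 can keep k̄ζ within the quantizer's range u0/(1-δ) for all k̄ ≥ k*; that this bound is never exceeded is proved as part of the conclusion. *)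

theory Defs
  imports "HOL-Analysis.Analysis"
begin

text \<open>
  The Uniform Lyapunov Property of \<open>x' = F x \<mu>\<close>, \<open>\<mu> \<in> P\<close>. The Lyapunov function is a function
  on \<open>A\<close>; its values outside \<open>A\<close> are junk, so its sublevel set at level \<open>c + 1\<close> is
  \<open>{x \<in> A. V x \<le> c + 1}\<close> and its inclusion in \<open>A\<close> needs no separate clause. The
  function \<open>DV\<close> is the gradient of \<open>V\<close>, so that \<open>DV x \<bullet> F x \<mu>\<close> is the derivative of \<open>V\<close>
  along the vector field.
\<close>
definition uniform_lyapunov ::
  "(real^'n \<Rightarrow> 'p \<Rightarrow> real^'n) \<Rightarrow> 'p set \<Rightarrow> (real^'n) set \<Rightarrow> real \<Rightarrow> (real^'n \<Rightarrow> real) \<Rightarrow> bool"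
where
  "uniform_lyapunov F P A c V \<longleftrightarrow>
     open A \<and> 1 \<le> c \<and>
     0 \<in> A \<and> V 0 = 0 \<and> (\<forall>x\<in>A. x \<noteq> 0 \<longrightarrow> 0 < V x) \<and>
     (\<exists>DV. (\<forall>x\<in>A. (V has_derivative (\<lambda>h. DV x \<bullet> h)) (at x)) \<and> continuous_on A DV \<and>
        (\<forall>x\<in>A. V x \<le> c + 1 \<longrightarrow> x \<noteq> 0 \<longrightarrow> (\<forall>\<mu>\<in>P. DV x \<bullet> F x \<mu> < 0)))"

definition W_dom :: "(real^'n) set \<Rightarrow> (real^'n \<Rightarrow> real) \<Rightarrow> real \<Rightarrow> real \<Rightarrow> ((real^'n) \<times> real) set"
where
  "W_dom A V c d = {x \<in> A. V x < c + 1} \<times> {\<zeta>. \<zeta>\<^sup>2 < d + 1}"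

definition W :: "(real^'n \<Rightarrow> real) \<Rightarrow> real \<Rightarrow> real \<Rightarrow> (real^'n) \<times> real \<Rightarrow> real" where
  "W V c d = (\<lambda>(x, \<zeta>). c * V x / (c + 1 - V x) + d * \<zeta>\<^sup>2 / (d + 1 - \<zeta>\<^sup>2))"

definition Omega ::
  "(real^'n) set \<Rightarrow> (real^'n \<Rightarrow> real) \<Rightarrow> real \<Rightarrow> real \<Rightarrow> real \<Rightarrow> ((real^'n) \<times> real) set"
where
  "Omega A V c d l = {y \<in> W_dom A V c d. W V c d y \<le> l}"

definition qlevel :: "real \<Rightarrow> real \<Rightarrow> nat \<Rightarrow> real" where
  "qlevel u0 \<delta> i = ((1 - \<delta>) / (1 + \<delta>)) ^ i * u0"

text \<open>
  The quantizer is defined only for \<open>\<bar>r\<bar> \<le> u0 / (1 - \<delta>)\<close>. The predicate says that the total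
  function \<open>\<Psi>\<close> agrees with it there and leaves \<open>\<Psi>\<close> unconstrained elsewhere; statements about
  all such \<open>\<Psi>\<close> therefore do not depend on how the quantizer is extended.
  For an input \<open>r = k * \<zeta>\<close> to stay within the bound, \<open>u0\<close> has to grow with the gain \<open>k\<close>.
\<close>
definition log_quantizer :: "real \<Rightarrow> nat \<Rightarrow> real \<Rightarrow> (real \<Rightarrow> real) \<Rightarrow> bool" where
  "log_quantizer u0 j \<delta> \<Psi> \<longleftrightarrow>
     (\<forall>i\<le>j. \<forall>r. qlevel u0 \<delta> i / (1 + \<delta>) < r \<and> r \<le> qlevel u0 \<delta> i / (1 - \<delta>)
        \<longrightarrow> \<Psi> r = qlevel u0 \<delta> i) \<and>
     (\<forall>r. 0 \<le> r \<and> r \<le> qlevel u0 \<delta> j / (1 + \<delta>) \<longrightarrow> \<Psi> r = 0) \<and>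
     (\<forall>r. - (u0 / (1 - \<delta>)) \<le> r \<and> r < 0 \<longrightarrow> \<Psi> r = - \<Psi> (- r))"

lemma qlevel_Suc:
  assumes "0 < \<delta>" "\<delta> < 1"
  shows "qlevel u0 \<delta> (Suc i) / (1 - \<delta>) = qlevel u0 \<delta> i / (1 + \<delta>)"
  using assms by (simp add: qlevel_def)

lemma qlevel_antimono:
  assumes "0 < u0" "0 < \<delta>" "\<delta> < 1" "i \<le> k"
  shows "qlevel u0 \<delta> k \<le> qlevel u0 \<delta> i"
proof -
  have "((1 - \<delta>) / (1 + \<delta>)) ^ k \<le> ((1 - \<delta>) / (1 + \<delta>)) ^ i"
    using assms by (intro power_decreasing) auto
  then show ?thesis
    using assms by (simp add: qlevel_def)
qed

lemma log_quantizer_exists: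
  assumes u0: "0 < u0" and \<delta>: "0 < \<delta>" "\<delta> < 1"
  shows "\<exists>\<Psi>. log_quantizer u0 j \<delta> \<Psi>"
proof -
  let ?u = "qlevel u0 \<delta>"
  define g where
    "g r = (if r \<le> ?u j / (1 + \<delta>) then 0 else ?u (LEAST i. ?u i / (1 + \<delta>) < r))" for r
  define \<Psi> where "\<Psi> r = (if 0 \<le> r then g r else - g (- r))" for r
  have upos: "0 < ?u i" for i
    using u0 \<delta> by (simp add: qlevel_def)
  have "\<Psi> r = ?u i" if i: "i \<le> j" "?u i / (1 + \<delta>) < r" "r \<le> ?u i / (1 - \<delta>)" for i r
  proof -
    have "?u j / (1 + \<delta>) \<le> ?u i / (1 + \<delta>)"
      using qlevel_antimono[OF u0 \<delta> i(1)] \<delta> by (simp add: divide_right_mono)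
    then have not_dead: "\<not> r \<le> ?u j / (1 + \<delta>)"
      using i by linarith
    have "(LEAST i. ?u i / (1 + \<delta>) < r) = i"
    proof (rule Least_equality)
      fix m assume m: "?u m / (1 + \<delta>) < r"
      show "i \<le> m"
      proof (rule ccontr)
        assume "\<not> i \<le> m"
        then have "?u i / (1 - \<delta>) \<le> ?u (Suc m) / (1 - \<delta>)"
          using qlevel_antimono[OF u0 \<delta>, of "Suc m" i] \<delta> by (simp add: divide_right_mono)
        then show False
          using m i(3) qlevel_Suc[OF \<delta>, of u0 m] by linarith
      qed
    qed (use i in simp)
    moreover have "0 < r"
      using i(2) upos[of i] \<delta> by (smt (verit) divide_pos_pos)
    ultimately show ?thesis
      using not_dead by (simp add: \<Psi>_def g_def)
  qed
  then have "log_quantizer u0 j \<delta> \<Psi>"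
    by (auto simp: log_quantizer_def \<Psi>_def g_def)
  then show ?thesis by blast
qed

lemma log_quantizer_unique:
  assumes \<delta>: "0 < \<delta>" "\<delta> < 1"
    and q: "log_quantizer u0 j \<delta> \<Psi>" "log_quantizer u0 j \<delta> \<Psi>'"
    and r: "\<bar>r\<bar> \<le> u0 / (1 - \<delta>)"
  shows "\<Psi> r = \<Psi>' r"
proof -
  let ?u = "qlevel u0 \<delta>"
  have cover: "r \<le> ?u j / (1 + \<delta>) \<or> (\<exists>i\<le>j. ?u i / (1 + \<delta>) < r \<and> r \<le> ?u i / (1 - \<delta>))"
    if "r \<le> u0 / (1 - \<delta>)" for r j
  proof (induction j)
    case 0
    then show ?case using that by (auto simp: qlevel_def)
  next
    case (Suc j)
    then show ?case using qlevel_Suc[OF \<delta>, of u0 j]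
      by (metis le_SucI linorder_le_less_linear order_refl)
  qed
  have nonneg: "\<Psi> r = \<Psi>' r" if "0 \<le> r" "r \<le> u0 / (1 - \<delta>)" for r
    using cover[OF that(2), of j] that(1) q unfolding log_quantizer_def by metis
  show ?thesis
  proof (cases "0 \<le> r")
    case True
    then show ?thesis using nonneg r by simp
  next
    case False
    then have "\<Psi> (- r) = \<Psi>' (- r)" using nonneg r by simp
    then show ?thesis using False r q unfolding log_quantizer_def by auto
  qed
qed

definition closed_loop ::
  "(real^'n \<Rightarrow> 'p \<Rightarrow> real^'n) \<Rightarrow> (real^'n \<Rightarrow> 'p \<Rightarrow> real^'n) \<Rightarrow>
   (real^'n \<Rightarrow> real \<Rightarrow> 'p \<Rightarrow> real) \<Rightarrow> (real^'n \<Rightarrow> real \<Rightarrow> 'p \<Rightarrow> real) \<Rightarrow>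
   'p \<Rightarrow> (real \<Rightarrow> real) \<Rightarrow> real \<Rightarrow> (real^'n) \<times> real \<Rightarrow> (real^'n) \<times> real"
where
  "closed_loop F G q b \<mu> \<Psi> k =
     (\<lambda>(x, \<zeta>). (F x \<mu> + \<zeta> *\<^sub>R G x \<mu>, q x \<zeta> \<mu> - b x \<zeta> \<mu> * \<Psi> (k * \<zeta>)))"

definition krasowskii :: "('a::real_normed_vector \<Rightarrow> 'b::real_normed_vector) \<Rightarrow> 'a \<Rightarrow> 'b set"
where
  "krasowskii h y = (\<Inter>\<epsilon>\<in>{0<..}. closure (convex hull (h ` ball y \<epsilon>)))"

text \<open>
  The usual epsilon-delta definition. The finite family of non-overlapping compact
  intervals is rendered by \<open>division_of\<close>; each member \<open>I\<close> is \<open>{Inf I..Sup I}\<close>.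
\<close>
definition abs_continuous_on :: "real set \<Rightarrow> (real \<Rightarrow> 'a::real_normed_vector) \<Rightarrow> bool" where
  "abs_continuous_on S f \<longleftrightarrow>
     (\<forall>\<epsilon>>0. \<exists>\<delta>>0. \<forall>D. D division_of \<Union>D \<and> \<Union>D \<subseteq> S \<and> (\<Sum>I\<in>D. Sup I - Inf I) < \<delta> \<longrightarrow>
        (\<Sum>I\<in>D. norm (f (Sup I) - f (Inf I))) < \<epsilon>)"

text \<open>
  A solution is a curve on \<open>[0, \<infinity>)\<close>; its values at negative times are junk. Absolute continuity
  on the unbounded interval is meant on each compact subinterval, as usual for solutions of
  differential inclusions.
\<close>
definition krasowskii_solution ::
  "(real \<Rightarrow> 'a::real_normed_vector \<Rightarrow> 'a) \<Rightarrow> (real \<Rightarrow> 'a) \<Rightarrow> bool"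
where
  "krasowskii_solution H \<phi> \<longleftrightarrow>
     (\<forall>T>0. abs_continuous_on {0..T} \<phi>) \<and>
     (AE t in lebesgue. 0 \<le> t \<longrightarrow>
        (\<exists>v. (\<phi> has_vector_derivative v) (at t within {0..}) \<and> v \<in> krasowskii (H t) (\<phi> t)))"

end

theory Submission
  imports Defs
begin

text \<open>
  The function \<open>W\<close> decreases strictly along all solutions between a small level and a level
  slightly above the initial one, provided the gain is large and the dead zone of the quantizer is
  small. Let \<open>S\<close> be the compact set of points between these two levels. At points of \<open>S\<close> with
  \<open>\<zeta> = 0\<close> the derivative of \<open>W\<close> is a positive multiple of that of \<open>V\<close> along \<open>x' = F x \<mu>\<close>,
  hence negative. By compactness of \<open>S\<close> and of the parameter set there are \<open>K\<close> and
  \<open>\<epsilon> > 0\<close> such that the open-loop derivative of \<open>W\<close> is at most \<open>K \<zeta>\<^sup>2 - \<epsilon>\<close> on all of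
  \<open>S\<close> (lemma \<open>penalty_uniformly_negative\<close>).

  The feedback has to absorb \<open>K \<zeta>\<^sup>2\<close>. Outside the dead zone the quantizer lies in a sector,
  \<open>r \<Psi>(r) \<ge> (1 - \<delta>) r\<^sup>2\<close>, so a gain proportional to \<open>K\<close> suffices; inside the dead zone the
  feedback does no harm, and \<open>K \<zeta>\<^sup>2 \<le> \<epsilon> / 2\<close> if the zone is narrow enough. Taking \<open>u\<^sub>0\<close>
  proportional to the gain makes the width of the dead zone in \<open>\<zeta>\<close> depend on the number of
  levels alone, which decouples the two choices. Since all these bounds are linear in the
  velocity, they define half-spaces and carry over to the closed convex hulls in the Krasowskii
  regularization (lemmas \<open>krasowskii_halfspace\<close> and \<open>krasowskii_closed_loop_estimate\<close>).

  What remains is Lyapunov's argument for curves whose derivative exists only almost everywhere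
  (lemma \<open>krasowskii_sublevel_attracts\<close>). It rests on the fact that an absolutely continuous
  function whose derivative is almost everywhere at most \<open>m\<close> has increments at most \<open>m\<close> times
  the length of the interval (lemma \<open>abs_continuous_on_diff_le\<close>).
\<close>

section \<open>Absolutely continuous functions\<close>

lemma abs_continuous_on_subset:
  assumes "abs_continuous_on S f" "T \<subseteq> S"
  shows "abs_continuous_on T f"
  using assms unfolding abs_continuous_on_def by (meson order_trans)

lemma abs_continuous_on_lipschitz_compose:
  assumes f: "abs_continuous_on {a..b} f" and g: "L-lipschitz_on (f ` {a..b}) g"
  shows "abs_continuous_on {a..b} (\<lambda>t. g (f t))"
  unfolding abs_continuous_on_def
proof (intro allI impI)
  fix \<epsilon> :: real assume "\<epsilon> > 0"
  have L: "0 \<le> L" using g by (rule lipschitz_on_nonneg)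
  with \<open>\<epsilon> > 0\<close> have "\<epsilon> / (L + 1) > 0" by simp
  then obtain \<delta> where "\<delta> > 0" and \<delta>: "\<And>D. D division_of \<Union>D \<Longrightarrow> \<Union>D \<subseteq> {a..b} \<Longrightarrow>
      (\<Sum>I\<in>D. Sup I - Inf I) < \<delta> \<Longrightarrow> (\<Sum>I\<in>D. norm (f (Sup I) - f (Inf I))) < \<epsilon> / (L + 1)"
    using f unfolding abs_continuous_on_def by meson
  have "(\<Sum>I\<in>D. norm (g (f (Sup I)) - g (f (Inf I)))) < \<epsilon>"
    if D: "D division_of \<Union>D" "\<Union>D \<subseteq> {a..b}" "(\<Sum>I\<in>D. Sup I - Inf I) < \<delta>" for D
  proof -
    have "norm (g (f (Sup I)) - g (f (Inf I))) \<le> L * norm (f (Sup I) - f (Inf I))" if I: "I \<in> D" for I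
    proof -
      obtain u v where "I = cbox u v" "I \<noteq> {}" using division_ofD(3,4)[OF D(1) I] by auto
      moreover have "I \<subseteq> {a..b}" using D(2) I by blast
      ultimately have "Sup I \<in> {a..b}" "Inf I \<in> {a..b}"
        using \<open>I \<subseteq> {a..b}\<close> by auto
      then show ?thesis using lipschitz_onD[OF g] by (auto simp: dist_norm)
    qed
    then have "(\<Sum>I\<in>D. norm (g (f (Sup I)) - g (f (Inf I)))) \<le> L * (\<Sum>I\<in>D. norm (f (Sup I) - f (Inf I)))"
      by (simp add: sum_distrib_left sum_mono)
    also have "\<dots> \<le> L * (\<epsilon> / (L + 1))"
      using \<delta>[OF D] L by (intro mult_left_mono) auto
    also have "\<dots> < \<epsilon>" using L \<open>\<epsilon> > 0\<close> by (simp add: field_simps)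
    finally show ?thesis .
  qed
  with \<open>\<delta> > 0\<close> show "\<exists>\<delta>>0. \<forall>D. D division_of \<Union>D \<and> \<Union>D \<subseteq> {a..b} \<and> (\<Sum>I\<in>D. Sup I - Inf I) < \<delta> \<longrightarrow>
      (\<Sum>I\<in>D. norm (g (f (Sup I)) - g (f (Inf I)))) < \<epsilon>" by blast
qed

lemma abs_continuous_on_imp_continuous_on:
  assumes f: "abs_continuous_on {a..b} f"
  shows "continuous_on {a..b} f"
  unfolding continuous_on_iff
proof (intro ballI allI impI)
  fix t and e :: real assume t: "t \<in> {a..b}" and "e > 0"
  then obtain \<delta> where "\<delta> > 0" and \<delta>: "\<And>D. D division_of \<Union>D \<Longrightarrow> \<Union>D \<subseteq> {a..b} \<Longrightarrow>
      (\<Sum>I\<in>D. Sup I - Inf I) < \<delta> \<Longrightarrow> (\<Sum>I\<in>D. norm (f (Sup I) - f (Inf I))) < e"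
    using f unfolding abs_continuous_on_def by meson
  have *: "norm (f v - f u) < e" if "u \<le> v" "u \<in> {a..b}" "v \<in> {a..b}" "v - u < \<delta>" for u v
    using \<delta>[of "{{u..v}}"] that division_of_self[of u v] by auto
  have "dist (f s) (f t) < e" if "s \<in> {a..b}" "dist s t < \<delta>" for s
    using *[of s t] *[of t s] that t by (cases "s \<le> t") (auto simp: dist_norm norm_minus_commute)
  with \<open>\<delta> > 0\<close> show "\<exists>\<delta>>0. \<forall>s\<in>{a..b}. dist s t < \<delta> \<longrightarrow> dist (f s) (f t) < e" by blast
qed

text \<open>
  Distinct tags can share an interval only if it is a single point; a function that vanishes on
  single points therefore has the same sum over the tagged pieces and over their intervals.
\<close>
lemma sum_tagged_division_eq:
  fixes d :: "real set \<Rightarrow> 'a::comm_monoid_add"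
  assumes p: "p tagged_division_of S" and degenerate: "\<And>u. d {u} = 0"
  shows "(\<Sum>(x,k)\<in>p. d k) = sum d (snd ` p)"
proof -
  \<comment> \<open>The rule for sums over tagged divisions also looks at the empty interval, where
    \<open>Sup k - Inf k\<close> is unspecified; \<open>d'\<close> is given the value \<open>0\<close> there.\<close>
  define d' where "d' k = (if k = {} then 0 else d k)" for k
  have ne: "k \<noteq> {}" if "(x, k) \<in> p" for x k using tagged_division_ofD(2)[OF p that] by auto
  have "(\<Sum>(x,k)\<in>p. d k) = (\<Sum>(x,k)\<in>p. d' k)"
    using ne by (intro sum.cong) (auto simp: d'_def)
  also have "\<dots> = sum d' (snd ` p)"
  proof (rule sum.over_tagged_division_lemma[OF p])
    fix u v :: real assume "box u v = {}"
    then have "cbox u v = {} \<or> cbox u v = {u}" by (cases "u = v") auto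
    then show "d' (cbox u v) = 0" using degenerate by (auto simp: d'_def)
  qed
  also have "\<dots> = sum d (snd ` p)"
    using ne by (intro sum.cong) (auto simp: d'_def)
  finally show ?thesis .
qed

text \<open>
  The mean value inequality for absolutely continuous functions. A fine tagged division telescopes
  \<open>f b - f a\<close>; the pieces with tags outside the null set obey the derivative bound, and absolute
  continuity makes the contribution of the remaining pieces negligible.
\<close>
lemma abs_continuous_on_diff_le:
  fixes f :: "real \<Rightarrow> real"
  assumes ab: "a \<le> b" and ac: "abs_continuous_on {a..b} f" and N: "negligible N"
    and deriv: "\<And>t. t \<in> {a..b} \<Longrightarrow> t \<notin> N \<Longrightarrow>
      \<exists>D\<le>m. (f has_real_derivative D) (at t within {a..b})"
  shows "f b - f a \<le> m * (b - a)"
proof -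
  have bound: "f b - f a \<le> m * (b - a) + e * (b - a + 1 + \<bar>m\<bar>)" if e: "e > 0" for e
  proof -
    obtain \<delta> where "\<delta> > 0" and \<delta>: "\<And>D. D division_of \<Union>D \<Longrightarrow> \<Union>D \<subseteq> {a..b} \<Longrightarrow>
      (\<Sum>I\<in>D. Sup I - Inf I) < \<delta> \<Longrightarrow> (\<Sum>I\<in>D. norm (f (Sup I) - f (Inf I))) < e"
      using ac e unfolding abs_continuous_on_def by meson
    \<comment> \<open>The integral of the indicator of \<open>N\<close> vanishes, so for a fine enough gauge the intervals with
      tag in \<open>N\<close> have small total length; absolute continuity then makes the variation of \<open>f\<close>
      over them smaller than \<open>e\<close>.\<close>
    have "(indicator N has_integral (0::real)) {a..b}"
      using N unfolding negligible_def by (metis box_real(2))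
    moreover have "min \<delta> e > 0" using \<open>\<delta> > 0\<close> e by simp
    ultimately obtain \<gamma> where \<gamma>: "gauge \<gamma>" "\<And>\<D>. \<D> tagged_division_of {a..b} \<Longrightarrow> \<gamma> fine \<D> \<Longrightarrow>
        norm ((\<Sum>(x,k)\<in>\<D>. measure lborel k *\<^sub>R (indicator N x :: real)) - 0) < min \<delta> e"
      unfolding has_integral_real by meson
    \<comment> \<open>At a tag outside \<open>N\<close> the derivative controls every short interval around the tag with slope
      error at most \<open>e\<close>.\<close>
    have "\<exists>r>0. t \<in> {a..b} \<longrightarrow> t \<notin> N \<longrightarrow>
        (\<forall>u\<in>{a..b}. \<forall>v\<in>{a..b}. u \<le> t \<longrightarrow> t \<le> v \<longrightarrow> dist t u < r \<longrightarrow> dist t v < r \<longrightarrow>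
          f v - f u \<le> (m + e) * (v - u))" for t
    proof (cases "t \<in> {a..b} \<and> t \<notin> N")
      case True
      then obtain D where D: "D \<le> m" "(f has_derivative ((*) D)) (at t within {a..b})"
        using deriv by (auto simp: has_field_derivative_def)
      then obtain r where r: "r > 0" "\<And>y. y \<in> {a..b} \<Longrightarrow> norm (y - t) < r \<Longrightarrow>
          norm (f y - f t - D * (y - t)) \<le> e * norm (y - t)"
        using e unfolding has_derivative_within_alt by blast
      have "f v - f u \<le> (m + e) * (v - u)"
        if uv: "u \<in> {a..b}" "v \<in> {a..b}" "u \<le> t" "t \<le> v" "dist t u < r" "dist t v < r" for u v
      proof -
        have "f v - f t - D * (v - t) \<le> e * (v - t)"
          using r(2)[of v] uv by (auto simp: dist_real_def)
        moreover have "- (f u - f t - D * (u - t)) \<le> e * (t - u)"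
          using r(2)[of u] uv by (auto simp: dist_real_def)
        ultimately have "f v - f u \<le> (D + e) * (v - u)" by (simp add: algebra_simps)
        also have "\<dots> \<le> (m + e) * (v - u)" using D uv by (intro mult_right_mono) auto
        finally show ?thesis .
      qed
      then show ?thesis using r(1) by blast
    qed (auto intro: exI[of _ 1])
    then obtain r where r: "\<And>t. r t > 0" "\<And>t u v. t \<in> {a..b} \<Longrightarrow> t \<notin> N \<Longrightarrow> u \<in> {a..b} \<Longrightarrow> v \<in> {a..b} \<Longrightarrow>
        u \<le> t \<Longrightarrow> t \<le> v \<Longrightarrow> dist t u < r t \<Longrightarrow> dist t v < r t \<Longrightarrow> f v - f u \<le> (m + e) * (v - u)"
      by metis
    have "gauge (\<lambda>t. \<gamma> t \<inter> ball t (r t))"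
      using \<gamma>(1) r(1) by (intro gauge_Int gauge_ball_dependent) auto
    then obtain p where p: "p tagged_division_of {a..b}" and "(\<lambda>t. \<gamma> t \<inter> ball t (r t)) fine p"
      using fine_division_exists_real by blast
    then have fine: "\<gamma> fine p" "(\<lambda>t. ball t (r t)) fine p" by (auto simp: fine_Int)
    note fin = tagged_division_ofD(1)[OF p]
    have piece: "\<exists>u v. k = {u..v} \<and> u \<le> v \<and> x \<in> {u..v} \<and> u \<in> {a..b} \<and> v \<in> {a..b} \<and>
        dist x u < r x \<and> dist x v < r x" if xk: "(x, k) \<in> p" for x k
    proof -
      obtain u v where k: "k = {u..v}" using tagged_division_ofD(4)[OF p xk] by (auto simp: box_real)
      have x: "x \<in> k" "k \<subseteq> {a..b}" using tagged_division_ofD(2,3)[OF p xk] by auto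
      then have "u \<in> k" "v \<in> k" using k by auto
      moreover have "k \<subseteq> ball x (r x)" using fine(2) xk by (auto simp: fine_def)
      ultimately have "u \<in> ball x (r x)" "v \<in> ball x (r x)" by auto
      then show ?thesis using k x \<open>u \<in> k\<close> by (intro exI[of _ u] exI[of _ v]) auto
    qed
    define pN where "pN = {xk \<in> p. fst xk \<in> N}"
    have pNp: "pN \<subseteq> p" by (auto simp: pN_def)
    have tag: "pN tagged_partial_division_of {a..b}"
      using p pNp unfolding tagged_division_of_def by (blast intro: tagged_partial_division_subset)
    have len: "(\<Sum>(x,k)\<in>pN. Sup k - Inf k) < min \<delta> e"
    proof -
      have "(\<Sum>(x,k)\<in>pN. Sup k - Inf k) = (\<Sum>(x,k)\<in>p. measure lborel k *\<^sub>R (indicator N x :: real))"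
        using piece fin pNp by (intro sum.mono_neutral_cong_left) (force simp: pN_def)+
      then show ?thesis using \<gamma>(2)[OF p fine(1)] by (simp only: real_norm_def diff_0_right)
    qed
    have var: "(\<Sum>(x,k)\<in>pN. norm (f (Sup k) - f (Inf k))) < e"
    proof -
      note tag' = tagged_partial_division_of_Union_self[OF tag]
      have "(\<Sum>(x,k)\<in>pN. norm (f (Sup k) - f (Inf k))) = (\<Sum>k\<in>snd ` pN. norm (f (Sup k) - f (Inf k)))"
        by (rule sum_tagged_division_eq[OF tag']) simp
      also have "\<dots> < e"
      proof (rule \<delta>)
        show "snd ` pN division_of \<Union>(snd ` pN)" by (rule partial_division_of_tagged_division[OF tag])
        show "\<Union>(snd ` pN) \<subseteq> {a..b}"
          using tagged_division_ofD(3)[OF p] pNp by fastforce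
        have "(\<Sum>k\<in>snd ` pN. Sup k - Inf k) = (\<Sum>(x,k)\<in>pN. Sup k - Inf k)"
          by (rule sum_tagged_division_eq[OF tag', symmetric]) simp
        then show "(\<Sum>k\<in>snd ` pN. Sup k - Inf k) < \<delta>" using len by simp
      qed
      finally show ?thesis .
    qed
    have "f b - f a = (\<Sum>(x,k)\<in>p. f (Sup k) - f (Inf k))"
      using additive_tagged_division_1[OF ab p, of f] by simp
    \<comment> \<open>The slope bound is charged to every interval, so that these terms telescope. Where the tag is
      in \<open>N\<close>, the variation of \<open>f\<close> is added, and the term with \<open>\<bar>m\<bar>\<close> cancels the charge
      in case \<open>m\<close> is negative.\<close>
    also have "\<dots> \<le> (\<Sum>(x,k)\<in>p. (m + e) * (Sup k - Inf k) +
        (if x \<in> N then norm (f (Sup k) - f (Inf k)) + \<bar>m\<bar> * (Sup k - Inf k) else 0))"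
    proof (rule sum_mono, clarify)
      fix x k assume xk: "(x, k) \<in> p"
      from piece[OF xk] obtain u v where uv: "k = {u..v}" "u \<le> v" "x \<in> {u..v}" "u \<in> {a..b}"
        "v \<in> {a..b}" "dist x u < r x" "dist x v < r x" by blast
      show "f (Sup k) - f (Inf k) \<le> (m + e) * (Sup k - Inf k) +
        (if x \<in> N then norm (f (Sup k) - f (Inf k)) + \<bar>m\<bar> * (Sup k - Inf k) else 0)"
      proof (cases "x \<in> N")
        case True
        have "0 \<le> (m + \<bar>m\<bar> + e) * (v - u)" using uv e by (intro mult_nonneg_nonneg) auto
        then have "0 \<le> (m + e) * (v - u) + \<bar>m\<bar> * (v - u)" by (simp add: algebra_simps)
        then show ?thesis using True uv by simp
      next
        case False
        then show ?thesis using r(2)[of x u v] uv by simp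
      qed
    qed
    also have "\<dots> = (m + e) * (\<Sum>(x,k)\<in>p. Sup k - Inf k) +
        (\<Sum>(x,k)\<in>p. if x \<in> N then norm (f (Sup k) - f (Inf k)) + \<bar>m\<bar> * (Sup k - Inf k) else 0)"
      by (simp add: sum.distrib sum_distrib_left case_prod_unfold)
    also have "(\<Sum>(x,k)\<in>p. Sup k - Inf k) = b - a"
      using additive_tagged_division_1[OF ab p, of "\<lambda>x. x"] by simp
    also have "(\<Sum>(x,k)\<in>p. if x \<in> N then norm (f (Sup k) - f (Inf k)) + \<bar>m\<bar> * (Sup k - Inf k) else 0)
        = (\<Sum>(x,k)\<in>pN. norm (f (Sup k) - f (Inf k))) + \<bar>m\<bar> * (\<Sum>(x,k)\<in>pN. Sup k - Inf k)"
    proof -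
      have "(\<Sum>(x,k)\<in>p. if x \<in> N then norm (f (Sup k) - f (Inf k)) + \<bar>m\<bar> * (Sup k - Inf k) else 0)
        = (\<Sum>(x,k)\<in>pN. norm (f (Sup k) - f (Inf k)) + \<bar>m\<bar> * (Sup k - Inf k))"
        by (rule sum.mono_neutral_cong_right[OF fin pNp]) (simp_all add: pN_def case_prod_unfold)
      then show ?thesis by (simp add: sum.distrib sum_distrib_left case_prod_unfold)
    qed
    also have "(m + e) * (b - a) + ((\<Sum>(x,k)\<in>pN. norm (f (Sup k) - f (Inf k))) +
        \<bar>m\<bar> * (\<Sum>(x,k)\<in>pN. Sup k - Inf k)) \<le> (m + e) * (b - a) + (e + \<bar>m\<bar> * e)"
      using len var by (intro add_left_mono add_mono mult_left_mono) auto
    finally show ?thesis by (simp add: algebra_simps)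
  qed
  show ?thesis
  proof (rule field_le_epsilon)
    fix e' :: real assume "e' > 0"
    define M where "M = b - a + 1 + \<bar>m\<bar>"
    have "M > 0" using ab by (simp add: M_def)
    with \<open>e' > 0\<close> bound[of "e' / M"] show "f b - f a \<le> m * (b - a) + e'"
      by (simp add: M_def[symmetric])
  qed
qed

section \<open>Lyapunov functions along Krasowskii solutions\<close>

text \<open>
  The compact set may fail to be convex, so the gradient bound gives a Lipschitz constant only
  locally; compactness makes it global. This makes \<open>w \<circ> \<phi>\<close> absolutely continuous for a curve
  \<open>\<phi>\<close> in \<open>U\<close>.
\<close>
lemma C1_imp_lipschitz_on_compact:
  fixes w :: "'a::euclidean_space \<Rightarrow> real"
  assumes U: "open U" and gw: "\<And>y. y \<in> U \<Longrightarrow> (w has_derivative (\<lambda>h. gw y \<bullet> h)) (at y)"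
    and cont: "continuous_on U gw" and C: "compact C" "C \<subseteq> U"
  obtains L where "L-lipschitz_on C w"
proof -
  have "local_lipschitz {0::real} C (\<lambda>_. w)"
  proof (rule local_lipschitzI)
    fix t :: real and x assume "x \<in> C"
    then obtain u where u: "u > 0" "cball x u \<subseteq> U"
      using U C(2) open_contains_cball by (metis subsetD)
    have "compact ((\<lambda>y. norm (gw y)) ` cball x u)"
      using u(2) cont by (intro compact_continuous_image continuous_on_norm) (auto intro: continuous_on_subset)
    then obtain B where B: "\<And>y. y \<in> cball x u \<Longrightarrow> norm (gw y) \<le> B"
      using compact_imp_bounded bounded_real by (metis (no_types, lifting) abs_norm_cancel imageI)
    have "B-lipschitz_on (cball x u) w"
    proof (rule bounded_derivative_imp_lipschitz)
      show "(w has_derivative (\<lambda>h. gw y \<bullet> h)) (at y within cball x u)" if "y \<in> cball x u" for y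
        using gw that u(2) by (blast intro: has_derivative_at_withinI)
      show "onorm (\<lambda>h. gw y \<bullet> h) \<le> B" if "y \<in> cball x u" for y
        proof (rule onorm_le)
          show "norm (gw y \<bullet> h) \<le> B * norm h" for h
            using Cauchy_Schwarz_ineq2[of "gw y" h] mult_right_mono[OF B[OF that], of "norm h"] by simp
        qed
      show "0 \<le> B" using B[of x] u(1) by (smt (verit) centre_in_cball norm_ge_zero)
    qed auto
    then show "\<exists>u>0. \<exists>L. \<forall>t\<in>cball t u \<inter> {0}. L-lipschitz_on (cball x u \<inter> C) w"
      using u(1) lipschitz_on_subset by blast
  qed
  from local_lipschitz_compact_implies_lipschitz[OF this C(1)] that show ?thesis
    by (metis compact_sing continuous_on_const singletonI)
qed

text \<open>
  A closed half-space is closed and convex, so it contains the closed convex hull of the values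
  of \<open>h\<close> near \<open>y\<close> as soon as it contains these values. This is how a linear estimate for a
  discontinuous field passes to its Krasowskii regularization.
\<close>
lemma krasowskii_halfspace:
  fixes h :: "'a::real_normed_vector \<Rightarrow> 'b::real_inner"
  assumes v: "v \<in> krasowskii h y"
    and near: "\<And>e. e > 0 \<Longrightarrow> \<forall>\<^sub>F z in at y. g \<bullet> h z \<le> m + e" and at: "g \<bullet> h y \<le> m"
  shows "g \<bullet> v \<le> m"
proof (rule field_le_epsilon)
  fix e :: real assume e: "e > 0"
  have "\<forall>\<^sub>F z in nhds y. g \<bullet> h z \<le> m + e"
    using near[OF e] at e by (auto simp: eventually_nhds_conv_at)
  then obtain \<epsilon> where \<epsilon>: "\<epsilon> > 0" "\<And>z. dist z y < \<epsilon> \<Longrightarrow> g \<bullet> h z \<le> m + e"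
    by (auto simp: eventually_nhds_metric)
  have "h ` ball y \<epsilon> \<subseteq> {z. g \<bullet> z \<le> m + e}"
    using \<epsilon>(2) by (auto simp: dist_commute)
  then have "closure (convex hull (h ` ball y \<epsilon>)) \<subseteq> {z. g \<bullet> z \<le> m + e}"
    by (intro closure_minimal hull_minimal convex_halfspace_le closed_halfspace_le)
  then show "g \<bullet> v \<le> m + e"
    using v \<epsilon>(1) by (auto simp: krasowskii_def)
qed

text \<open>
  Lyapunov's argument for Krasowskii solutions. As long as the solution runs between the levels
  \<open>s\<close> and \<open>L + 1\<close>, \<open>w\<close> decreases along it at rate \<open>\<epsilon>\<close>; hence it cannot leave a
  sublevel set between \<open>s\<close> and \<open>L\<close>, and it cannot stay above \<open>s\<close> forever. The
  compact sublevel sets keep the solution away from the boundary of \<open>U\<close>.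
\<close>
lemma krasowskii_sublevel_attracts:
  fixes w :: "'a::euclidean_space \<Rightarrow> real"
  assumes U: "open U" and gw: "\<And>y. y \<in> U \<Longrightarrow> (w has_derivative (\<lambda>h. gw y \<bullet> h)) (at y)"
    and cont: "continuous_on U gw"
    and proper: "\<And>l. 0 < l \<Longrightarrow> compact {y \<in> U. w y \<le> l}"
    and s: "0 < s" "s \<le> L" and \<epsilon>: "0 < \<epsilon>"
    and decay: "\<And>y v. y \<in> U \<Longrightarrow> s \<le> w y \<Longrightarrow> w y \<le> L + 1 \<Longrightarrow> v \<in> krasowskii h y \<Longrightarrow> gw y \<bullet> v \<le> - \<epsilon>"
    and sol: "krasowskii_solution (\<lambda>t. h) \<phi>"
    and init: "\<phi> 0 \<in> U" "w (\<phi> 0) \<le> L"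
  shows "\<And>t. 0 \<le> t \<Longrightarrow> \<phi> t \<in> U \<and> w (\<phi> t) \<le> L"
    and "\<exists>T>0. \<forall>t\<ge>T. \<phi> t \<in> U \<and> w (\<phi> t) \<le> s"
proof -
  have w_cont: "continuous_on U w"
    by (rule has_derivative_continuous_on) (rule has_derivative_at_withinI[OF gw])
  obtain N where N: "negligible N" and ode: "\<And>t. 0 \<le> t \<Longrightarrow> t \<notin> N \<Longrightarrow>
      \<exists>v. (\<phi> has_vector_derivative v) (at t within {0..}) \<and> v \<in> krasowskii h (\<phi> t)"
    using sol unfolding krasowskii_solution_def eventually_ae_filter_negligible by blast
  have ac: "abs_continuous_on {a..b} \<phi>" if "0 \<le> a" for a b
  proof -
    have "abs_continuous_on {0..max b 1} \<phi>" using sol by (auto simp: krasowskii_solution_def)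
    then show ?thesis by (rule abs_continuous_on_subset) (use that in auto)
  qed
  have \<phi>_cont: "continuous_on {a..b} \<phi>" if "0 \<le> a" for a b
    using ac[OF that] by (rule abs_continuous_on_imp_continuous_on)

  have decrease: "w (\<phi> b) \<le> w (\<phi> a) - \<epsilon> * (b - a)"
    if ab: "0 \<le> a" "a \<le> b" and band: "\<And>t. t \<in> {a..b} \<Longrightarrow> \<phi> t \<in> U \<and> s \<le> w (\<phi> t) \<and> w (\<phi> t) \<le> L + 1" for a b
  proof -
    have "compact (\<phi> ` {a..b})" "\<phi> ` {a..b} \<subseteq> U"
      using \<phi>_cont[OF ab(1)] band by (auto intro: compact_continuous_image)
    then obtain M where "M-lipschitz_on (\<phi> ` {a..b}) w"
      using C1_imp_lipschitz_on_compact[OF U gw cont] by blast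
    with ac[OF ab(1)] have "abs_continuous_on {a..b} (\<lambda>t. w (\<phi> t))"
      by (rule abs_continuous_on_lipschitz_compose)
    then have "w (\<phi> b) - w (\<phi> a) \<le> - \<epsilon> * (b - a)"
    proof (rule abs_continuous_on_diff_le[OF ab(2) _ N])
      fix t assume t: "t \<in> {a..b}" "t \<notin> N"
      then obtain v where v: "(\<phi> has_vector_derivative v) (at t within {0..})" "v \<in> krasowskii h (\<phi> t)"
        using ode[of t] ab by auto
      from v(1) have "(\<phi> has_vector_derivative v) (at t within {a..b})"
        by (rule has_vector_derivative_within_subset) (use ab in auto)
      then have "((\<lambda>t. w (\<phi> t)) has_derivative (\<lambda>x. gw (\<phi> t) \<bullet> (x *\<^sub>R v))) (at t within {a..b})"
        unfolding has_vector_derivative_def using gw band[OF t(1)]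
        by (intro has_derivative_compose[of \<phi> _ _ _ w]) auto
      then have "((\<lambda>t. w (\<phi> t)) has_real_derivative gw (\<phi> t) \<bullet> v) (at t within {a..b})"
        by (simp add: has_field_derivative_def mult.commute[of _ "gw (\<phi> t) \<bullet> v"])
      moreover have "gw (\<phi> t) \<bullet> v \<le> - \<epsilon>" using decay[OF _ _ _ v(2)] band[OF t(1)] by blast
      ultimately show "\<exists>D\<le>- \<epsilon>. ((\<lambda>t. w (\<phi> t)) has_real_derivative D) (at t within {a..b})" by blast
    qed
    then show ?thesis by simp
  qed

  have invariant: "\<phi> b \<in> U \<and> w (\<phi> b) \<le> l"
    if l: "s \<le> l" "l \<le> L" and ab: "0 \<le> a" "a \<le> b" and start: "\<phi> a \<in> U" "w (\<phi> a) \<le> l" for a b l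
  proof (rule ccontr)
    assume out: "\<not> (\<phi> b \<in> U \<and> w (\<phi> b) \<le> l)"
    define C where "C = {y \<in> U. w y \<le> l}"
    define Z where "Z = {a..b} \<inter> \<phi> -` C"
    have "closed C" using proper[of l] s l by (auto simp: C_def compact_imp_closed)
    then have "closed Z" unfolding Z_def
      by (intro continuous_closed_preimage \<phi>_cont ab closed_atLeastAtMost)
    moreover have "a \<in> Z" using ab start by (simp add: Z_def C_def)
    moreover have bdd: "bdd_above Z" by (auto simp: Z_def)
    \<comment> \<open>The last visit to the sublevel set is attained because that set is closed.\<close>
    ultimately have t0Z: "Sup Z \<in> Z" using closed_contains_Sup by blast
    define t0 where "t0 = Sup Z"
    have t0: "a \<le> t0" "t0 \<le> b" "\<phi> t0 \<in> U" "w (\<phi> t0) \<le> l"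
      using t0Z by (auto simp: Z_def C_def t0_def)
    with out have "t0 < b" by (metis order_le_less)
    have after: "\<not> (\<phi> t \<in> U \<and> w (\<phi> t) \<le> l)" if "t0 < t" "t \<le> b" for t
      using cSup_upper[OF _ bdd, of t] that t0(1) by (fastforce simp: Z_def C_def t0_def)
    \<comment> \<open>Just after this last visit the curve is still in the region where \<open>decay\<close> applies, since
      \<open>l + 1 \<le> L + 1\<close>; so \<open>w\<close> falls below \<open>l\<close>, which is absurd.\<close>
    have "open (U \<inter> w -` {..<l + 1})"
      using w_cont U by (intro continuous_open_preimage) auto
    moreover have "(\<phi> \<longlongrightarrow> \<phi> t0) (at t0 within {t0..b})"
      using \<phi>_cont[of t0 b] ab t0 \<open>t0 < b\<close> by (auto simp: continuous_on_def)
    ultimately have "\<forall>\<^sub>F t in at t0 within {t0..b}. \<phi> t \<in> U \<inter> w -` {..<l + 1}"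
      using t0 by (intro topological_tendstoD) auto
    then obtain r where r: "r > 0" "\<And>t. t \<in> {t0..b} \<Longrightarrow> t \<noteq> t0 \<Longrightarrow> dist t t0 < r \<Longrightarrow> \<phi> t \<in> U \<and> w (\<phi> t) < l + 1"
      by (auto simp: eventually_at)
    define t1 where "t1 = min b (t0 + r / 2)"
    have t1: "t0 < t1" "t1 \<le> b" "t1 - t0 < r" using r(1) \<open>t0 < b\<close> by (auto simp: t1_def)
    have near: "\<phi> t \<in> U \<and> l < w (\<phi> t) \<and> w (\<phi> t) < l + 1" if "t0 < t" "t \<le> t1" for t
      using r(2)[of t] after[of t] that t1 by (auto simp: dist_real_def)
    have "l \<le> w (\<phi> t0)"
    proof (rule tendsto_lowerbound)
      show "((\<lambda>t. w (\<phi> t)) \<longlongrightarrow> w (\<phi> t0)) (at t0 within {t0..t1})"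
      proof -
        have "isCont w (\<phi> t0)" using gw[OF t0(3)] has_derivative_continuous by blast
        moreover have "(\<phi> \<longlongrightarrow> \<phi> t0) (at t0 within {t0..t1})"
          using \<phi>_cont[of t0 t1] ab t0 t1 by (auto simp: continuous_on_def)
        ultimately show ?thesis by (rule isCont_tendsto_compose)
      qed
      show "\<forall>\<^sub>F t in at t0 within {t0..t1}. l \<le> w (\<phi> t)"
        unfolding eventually_at_filter using near by (intro always_eventually) (auto simp: less_le)
      show "at t0 within {t0..t1} \<noteq> bot" using t1 by (simp add: at_within_Icc_at_right)
    qed
    then have "\<phi> t \<in> U \<and> s \<le> w (\<phi> t) \<and> w (\<phi> t) \<le> L + 1" if "t \<in> {t0..t1}" for t
      using near[of t] that t0 l by (cases "t = t0") auto
    then have "w (\<phi> t1) \<le> w (\<phi> t0) - \<epsilon> * (t1 - t0)"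
      using ab t0 t1 by (intro decrease) auto
    also have "\<dots> < l" using t0(4) t1(1) \<epsilon> by (smt (verit) mult_pos_pos)
    finally show False using near[of t1] t1 by simp
  qed

  show stay: "\<And>t. 0 \<le> t \<Longrightarrow> \<phi> t \<in> U \<and> w (\<phi> t) \<le> L"
    using invariant[of L 0] s init by simp
  \<comment> \<open>Staying above \<open>s\<close> up to this time would lower \<open>w\<close> by \<open>\<epsilon> * T > L\<close>.\<close>
  define T where "T = L / \<epsilon> + 1"
  have T: "0 < T" "L < \<epsilon> * T" using s \<epsilon> by (auto simp: T_def field_simps add_pos_pos)
  have "\<exists>t\<in>{0..T}. w (\<phi> t) \<le> s"
  proof (rule ccontr)
    assume "\<not> ?thesis"
    then have above: "s < w (\<phi> t)" if "t \<in> {0..T}" for t using that by (simp add: not_le)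
    have "w (\<phi> T) \<le> w (\<phi> 0) - \<epsilon> * (T - 0)"
    proof (rule decrease)
      show "\<phi> t \<in> U \<and> s \<le> w (\<phi> t) \<and> w (\<phi> t) \<le> L + 1" if "t \<in> {0..T}" for t
        using stay[of t] above[OF that] that by simp
    qed (use T in auto)
    moreover have "s < w (\<phi> T)" using above T by simp
    ultimately    show False using init T s by simp
  qed
  then obtain t where "t \<in> {0..T}" "w (\<phi> t) \<le> s" by blast
  then have "\<phi> t' \<in> U \<and> w (\<phi> t') \<le> s" if "T \<le> t'" for t'
    using s stay that by (intro invariant[of s t t']) auto
  then show "\<exists>T>0. \<forall>t\<ge>T. \<phi> t \<in> U \<and> w (\<phi> t) \<le> s" using T by blast
qed

section \<open>High-gain domination on compact sets\<close>

text \<open>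
  The compactness argument behind high-gain feedback: if \<open>a\<close> is negative where \<open>s\<close> vanishes, a
  large multiple of \<open>s\<close> makes it uniformly negative everywhere. For the closed loop, \<open>a\<close> is
  the open-loop derivative of \<open>W\<close> and \<open>s\<close> is \<open>\<zeta>\<^sup>2\<close>.
\<close>
lemma penalty_uniformly_negative:
  fixes a s :: "'a::topological_space \<Rightarrow> real"
  assumes C: "compact C" and a: "continuous_on C a" and s: "continuous_on C s"
    and s_nonneg: "\<And>p. p \<in> C \<Longrightarrow> 0 \<le> s p"
    and neg: "\<And>p. p \<in> C \<Longrightarrow> s p = 0 \<Longrightarrow> a p < 0"
  obtains K \<epsilon> where "0 < K" "0 < \<epsilon>" "\<And>p. p \<in> C \<Longrightarrow> a p - K * s p \<le> - \<epsilon>"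
proof -
  \<comment> \<open>Only on \<open>Z\<close> is a penalty needed, and there \<open>s\<close> is bounded away from \<open>0\<close>.\<close>
  define Z where "Z = C \<inter> a -` {0..}"
  have Z: "compact Z" "Z \<subseteq> C"
    using closedin_compact[OF C continuous_closedin_preimage[OF a, of "{0..}"]] by (auto simp: Z_def)
  obtain K where K: "0 < K" "\<And>p. p \<in> Z \<Longrightarrow> a p - K * s p < 0"
  proof (cases "Z = {}")
    case True
    then show ?thesis using that[of 1] by simp
  next
    case False
    have "continuous_on Z a" "continuous_on Z s"
      using a s Z(2) by (auto intro: continuous_on_subset)
    then obtain p q where p: "p \<in> Z" "\<And>y. y \<in> Z \<Longrightarrow> a y \<le> a p" and q: "q \<in> Z" "\<And>y. y \<in> Z \<Longrightarrow> s q \<le> s y"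
      using continuous_attains_sup[OF Z(1) False] continuous_attains_inf[OF Z(1) False] by metis
    have a0: "0 \<le> a p" using p(1) by (simp add: Z_def)
    have s0: "0 < s q"
      using q(1) s_nonneg[of q] neg[of q] by (auto simp: Z_def less_le)
    define K where "K = (a p + 1) / s q"
    have "K > 0" using a0 s0 by (simp add: K_def)
    moreover have "a y - K * s y < 0" if "y \<in> Z" for y
    proof -
      have "a y < K * s q" using p(2)[OF that] s0 by (simp add: K_def)
      also have "\<dots> \<le> K * s y" using q(2)[OF that] \<open>K > 0\<close> by simp
      finally show ?thesis by simp
    qed
    ultimately show ?thesis using that by blast
  qed
  have below: "a p - K * s p < 0" if "p \<in> C" for p
  proof (cases "p \<in> Z")
    case False
    then have "a p < 0" using that by (simp add: Z_def)
    moreover have "0 \<le> K * s p" using K(1) s_nonneg[OF that] by simp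
    ultimately show ?thesis by linarith
  qed (use K in auto)
  show ?thesis
  proof (cases "C = {}")
    case True
    then show ?thesis using that[of 1 1] by simp
  next
    case False
    have "continuous_on C (\<lambda>p. a p - K * s p)" by (intro continuous_intros a s)
    then have "\<exists>p\<in>C. \<forall>y\<in>C. a y - K * s y \<le> a p - K * s p"
      by (rule continuous_attains_sup[OF C False])
    then obtain p where "p \<in> C" "\<And>y. y \<in> C \<Longrightarrow> a y - K * s y \<le> a p - K * s p"
      by blast
    then show ?thesis using that[of K "- (a p - K * s p)"] K(1) below by simp
  qed
qed

section \<open>The quantized closed loop\<close>

text \<open>
  The logarithmic spacing makes the relative error of \<open>\<Psi>\<close> at most \<open>\<delta>\<close> outside the dead
  zone, since \<open>r \<le> u\<^sub>i / (1 - \<delta>)\<close> gives \<open>u\<^sub>i \<ge> (1 - \<delta>) r\<close>. The separate multiplier \<open>s\<close>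
  is what the passage to the convex hull requires: there the gradient is taken at one point and
  \<open>\<Psi>\<close> at nearby points.
\<close>
lemma log_quantizer_sector:
  assumes \<delta>: "0 < \<delta>" "\<delta> < 1" and u0: "0 < u0" and \<Psi>: "log_quantizer u0 j \<delta> \<Psi>"
    and r: "\<bar>r\<bar> \<le> u0 / (1 - \<delta>)" and s: "0 < s * r"
  shows "0 \<le> s * \<Psi> r"
    and "qlevel u0 \<delta> j / (1 + \<delta>) < \<bar>r\<bar> \<Longrightarrow> (1 - \<delta>) * (s * r) \<le> s * \<Psi> r"
proof -
  let ?u = "qlevel u0 \<delta>"
  have cover: "r \<le> ?u j / (1 + \<delta>) \<or> (\<exists>i\<le>j. ?u i / (1 + \<delta>) < r \<and> r \<le> ?u i / (1 - \<delta>))"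
    if "r \<le> u0 / (1 - \<delta>)" for r j
  proof (induction j)
    case 0
    then show ?case using that by (auto simp: qlevel_def)
  next
    case (Suc j)
    then show ?case using qlevel_Suc[OF \<delta>, of u0 j]
      by (metis le_SucI linorder_le_less_linear order_refl)
  qed
  have pos: "0 \<le> \<Psi> r \<and> (?u j / (1 + \<delta>) < r \<longrightarrow> (1 - \<delta>) * r \<le> \<Psi> r)"
    if r: "0 < r" "r \<le> u0 / (1 - \<delta>)" for r
  proof (cases "r \<le> ?u j / (1 + \<delta>)")
    case True
    then show ?thesis using \<Psi> r unfolding log_quantizer_def by auto
  next
    case False
    then obtain i where i: "i \<le> j" "?u i / (1 + \<delta>) < r" "r \<le> ?u i / (1 - \<delta>)"
      using cover[OF r(2), of j] by auto
    then have "\<Psi> r = ?u i" using \<Psi> unfolding log_quantizer_def by blast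
    moreover have "(1 - \<delta>) * r \<le> ?u i" using i(3) \<delta> by (simp add: pos_le_divide_eq mult.commute)
    moreover have "0 \<le> (1 - \<delta>) * r" using \<delta> r by simp
    ultimately show ?thesis by linarith
  qed
  have "0 \<le> s * \<Psi> r \<and> (?u j / (1 + \<delta>) < \<bar>r\<bar> \<longrightarrow> (1 - \<delta>) * (s * r) \<le> s * \<Psi> r)"
  proof (cases "0 < r")
    case True
    then have "0 < s" using s by (simp add: zero_less_mult_iff)
    then show ?thesis using pos[of r] True r mult_left_mono[of "(1 - \<delta>) * r" "\<Psi> r" s]
      by (auto simp: algebra_simps)
  next
    case False
    then have neg: "r < 0" "s < 0" using s by (auto simp: zero_less_mult_iff)
    then have odd: "\<Psi> r = - \<Psi> (- r)" using \<Psi> r unfolding log_quantizer_def by auto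
    show ?thesis
      using pos[of "- r"] neg r odd mult_left_mono[of "(1 - \<delta>) * - r" "\<Psi> (- r)" "- s"]
      by (auto simp: algebra_simps mult_nonpos_nonneg)
  qed
  then show "0 \<le> s * \<Psi> r"
    and "?u j / (1 + \<delta>) < \<bar>r\<bar> \<Longrightarrow> (1 - \<delta>) * (s * r) \<le> s * \<Psi> r" by auto
qed

definition W_grad ::
  "(real^'n \<Rightarrow> real^'n) \<Rightarrow> (real^'n \<Rightarrow> real) \<Rightarrow> real \<Rightarrow> real \<Rightarrow> (real^'n) \<times> real \<Rightarrow> (real^'n) \<times> real"
where
  "W_grad DV V c d y =
     ((c * (c + 1) / (c + 1 - V (fst y))\<^sup>2) *\<^sub>R DV (fst y),
      2 * d * (d + 1) / (d + 1 - (snd y)\<^sup>2)\<^sup>2 * snd y)"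

text \<open>
  Both summands of \<open>W\<close> are functions of the form \<open>v \<mapsto> c v / (c + 1 - v)\<close>, taken at \<open>V x\<close>
  and, with \<open>d\<close> in place of \<open>c\<close>, at \<open>\<zeta>\<^sup>2\<close>. The derivative of such a function is
  \<open>c (c + 1) / (c + 1 - v)\<^sup>2\<close>; its positivity makes the gradient of \<open>W\<close> in \<open>x\<close> a positive
  multiple of that of \<open>V\<close>.
\<close>
lemma W_has_derivative:
  assumes V: "(V has_derivative (\<lambda>h. DV (fst y) \<bullet> h)) (at (fst y))"
    and y: "y \<in> W_dom A V c d"
  shows "(W V c d has_derivative (\<lambda>h. W_grad DV V c d y \<bullet> h)) (at y)"
proof -
  have ne: "c + 1 - V (fst y) \<noteq> 0" "d + 1 - (snd y)\<^sup>2 \<noteq> 0" using y by (auto simp: W_dom_def)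
  have W_eq: "W V c d = (\<lambda>y. c * V (fst y) / (c + 1 - V (fst y)) + d * (snd y)\<^sup>2 / (d + 1 - (snd y)\<^sup>2))"
    by (simp add: W_def fun_eq_iff)
  have "((\<lambda>v. c * v / (c + 1 - v)) has_real_derivative c * (c + 1) / (c + 1 - V (fst y))\<^sup>2) (at (V (fst y)))"
    using ne(1) by (auto intro!: derivative_eq_intros simp: power2_eq_square divide_simps) (auto simp: algebra_simps)
  moreover have V_fst: "((\<lambda>y. V (fst y)) has_derivative (\<lambda>h. DV (fst y) \<bullet> fst h)) (at y)"
    using has_derivative_compose[OF has_derivative_fst[OF has_derivative_ident] V] by simp
  ultimately have 1: "((\<lambda>y. c * V (fst y) / (c + 1 - V (fst y))) has_derivative
      (\<lambda>h. c * (c + 1) / (c + 1 - V (fst y))\<^sup>2 * (DV (fst y) \<bullet> fst h))) (at y)"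
    unfolding has_field_derivative_def by (rule has_derivative_compose[rotated])
  have "((\<lambda>z. d * z\<^sup>2 / (d + 1 - z\<^sup>2)) has_real_derivative 2 * d * (d + 1) / (d + 1 - (snd y)\<^sup>2)\<^sup>2 * snd y) (at (snd y))"
    using ne(2) by (auto intro!: derivative_eq_intros simp: power2_eq_square divide_simps) (auto simp: algebra_simps)
  then have 2: "((\<lambda>y. d * (snd y)\<^sup>2 / (d + 1 - (snd y)\<^sup>2)) has_derivative
      (\<lambda>h. 2 * d * (d + 1) / (d + 1 - (snd y)\<^sup>2)\<^sup>2 * snd y * snd h)) (at y)"
    unfolding has_field_derivative_def
    by (rule has_derivative_compose[OF has_derivative_snd[OF has_derivative_ident]])
  from has_derivative_add[OF 1 2] show ?thesis
    by (simp add: W_eq W_grad_def inner_prod_def)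
qed

text \<open>
  Here \<open>(g, \<gamma> \<zeta>)\<close> stands for the gradient of \<open>W\<close> at \<open>(x, \<zeta>)\<close>. Its second component
  is a nonnegative multiple of \<open>\<zeta>\<close>, so the quantized feedback never increases \<open>W\<close>, and
  outside the dead zone it acts at least as strongly as the linear feedback with gain
  \<open>b0 (1 - \<delta>) k\<close>. The estimate is linear in the velocity and stable under small displacements
  of the argument of \<open>\<Psi>\<close>, so it survives the convexification.
\<close>
lemma krasowskii_closed_loop_estimate:
  fixes F G :: "real^'n \<Rightarrow> 'p \<Rightarrow> real^'n"
  assumes \<delta>: "0 < \<delta>" "\<delta> < 1" and u0: "0 < u0" and k: "0 < k" and \<gamma>: "0 \<le> \<gamma>"
    and \<Psi>: "log_quantizer u0 j \<delta> \<Psi>"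
    and F: "isCont (\<lambda>x. F x \<mu>) x" and G: "isCont (\<lambda>x. G x \<mu>) x"
    and q: "isCont (\<lambda>y. q (fst y) (snd y) \<mu>) (x, \<zeta>)"
    and b: "0 < b0" "\<And>x \<zeta>. b0 \<le> b x \<zeta> \<mu>"
    and range: "\<bar>k * \<zeta>\<bar> < u0 / (1 - \<delta>)"
    and v: "v \<in> krasowskii (closed_loop F G q b \<mu> \<Psi> k) (x, \<zeta>)"
  shows "(g, \<gamma> * \<zeta>) \<bullet> v \<le> g \<bullet> (F x \<mu> + \<zeta> *\<^sub>R G x \<mu>) + \<gamma> * \<zeta> * q x \<zeta> \<mu> -
    (if qlevel u0 \<delta> j / (1 + \<delta>) < \<bar>k * \<zeta>\<bar> then \<gamma> * b0 * (1 - \<delta>) * k * \<zeta>\<^sup>2 else 0)"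
proof -
  let ?h = "closed_loop F G q b \<mu> \<Psi> k"
  define dead where "dead = qlevel u0 \<delta> j / (1 + \<delta>)"
  have dead0: "0 \<le> dead" using \<delta> u0 by (simp add: dead_def qlevel_def)
  define \<kappa> where "\<kappa> = (if dead < \<bar>k * \<zeta>\<bar> then \<gamma> * b0 * (1 - \<delta>) * k else 0)"
  \<comment> \<open>This continuous function dominates the discontinuous right-hand side near \<open>(x, \<zeta>)\<close>: the
    gradient \<open>(g, \<gamma> \<zeta>)\<close> and the coefficient \<open>\<kappa>\<close>, which switches at the edge of
    the dead zone, are frozen at their values at the centre.\<close>
  define \<Phi> where "\<Phi> y = g \<bullet> (F (fst y) \<mu> + snd y *\<^sub>R G (fst y) \<mu>) +
    \<gamma> * \<zeta> * q (fst y) (snd y) \<mu> - \<kappa> * (\<zeta> * snd y)" for y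
  have pointwise: "(g, \<gamma> * \<zeta>) \<bullet> ?h y \<le> \<Phi> y"
    if y: "\<bar>k * snd y\<bar> \<le> u0 / (1 - \<delta>)" "\<zeta> = 0 \<or> 0 < \<zeta> * snd y"
      "dead < \<bar>k * \<zeta>\<bar> \<Longrightarrow> dead < \<bar>k * snd y\<bar>" for y
  proof -
    have "\<kappa> * (\<zeta> * snd y) \<le> \<gamma> * (b (fst y) (snd y) \<mu> * (\<zeta> * \<Psi> (k * snd y)))"
    proof (cases "\<zeta> = 0")
      case False
      then have "0 < \<zeta> * snd y" using y(2) by simp
      then have same: "0 < \<zeta> * (k * snd y)" using k by (metis mult.left_commute mult_pos_pos)
      note sector = log_quantizer_sector[OF \<delta> u0 \<Psi> y(1) same]
      have "b0 * (\<zeta> * \<Psi> (k * snd y)) \<le> b (fst y) (snd y) \<mu> * (\<zeta> * \<Psi> (k * snd y))"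
        using sector(1) b by (intro mult_right_mono) auto
      then have *: "\<gamma> * (b0 * (\<zeta> * \<Psi> (k * snd y))) \<le> \<gamma> * (b (fst y) (snd y) \<mu> * (\<zeta> * \<Psi> (k * snd y)))"
        using \<gamma> by (intro mult_left_mono) auto
      have "\<kappa> * (\<zeta> * snd y) \<le> \<gamma> * (b0 * (\<zeta> * \<Psi> (k * snd y)))"
      proof (cases "dead < \<bar>k * \<zeta>\<bar>")
        case True
        then have "(1 - \<delta>) * (\<zeta> * (k * snd y)) \<le> \<zeta> * \<Psi> (k * snd y)"
          using sector(2) y(3) by (simp add: dead_def)
        then have "\<gamma> * (b0 * ((1 - \<delta>) * (\<zeta> * (k * snd y)))) \<le> \<gamma> * (b0 * (\<zeta> * \<Psi> (k * snd y)))"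
          using \<gamma> b(1) by (intro mult_left_mono) auto
        then show ?thesis using True by (simp add: \<kappa>_def mult_ac)
      next
        case False
        then show ?thesis using sector(1) \<gamma> b(1) by (simp add: \<kappa>_def)
      qed
      with * show ?thesis by linarith
    qed (use \<gamma> in simp)
    then show ?thesis
      by (simp add: \<Phi>_def closed_loop_def case_prod_unfold algebra_simps)
  qed
  have "isCont \<Phi> (x, \<zeta>)"
  proof -
    have "isCont (\<lambda>y. F (fst y) \<mu>) (x, \<zeta>)" "isCont (\<lambda>y. G (fst y) \<mu>) (x, \<zeta>)"
      using isCont_o2[of "(x, \<zeta>)" fst "\<lambda>x. F x \<mu>"] isCont_o2[of "(x, \<zeta>)" fst "\<lambda>x. G x \<mu>"] F G
      by (auto intro: continuous_intros)
    then show ?thesis unfolding \<Phi>_def by (intro continuous_intros q)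
  qed
  then have \<Phi>_lim: "(\<Phi> \<longlongrightarrow> \<Phi> (x, \<zeta>)) (at (x, \<zeta>))" by (simp add: isCont_def)
  have snd_lim: "(snd \<longlongrightarrow> \<zeta>) (at (x, \<zeta>))" by (auto intro!: tendsto_eq_intros)
  then have in_range: "\<forall>\<^sub>F y in at (x, \<zeta>). \<bar>k * snd y\<bar> < u0 / (1 - \<delta>)"
    by (intro order_tendstoD(2)[where y = "\<bar>k * \<zeta>\<bar>"] range tendsto_intros)
  have same_sign: "\<forall>\<^sub>F y in at (x, \<zeta>). \<zeta> = 0 \<or> 0 < \<zeta> * snd y"
  proof (cases "\<zeta> = 0")
    case False
    then have "0 < \<zeta> * \<zeta>" by (simp add: zero_less_mult_iff linorder_neq_iff disj_commute)
    then have "\<forall>\<^sub>F y in at (x, \<zeta>). 0 < \<zeta> * snd y"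
      by (intro order_tendstoD(1)[where y = "\<zeta> * \<zeta>"] tendsto_intros snd_lim)
    then show ?thesis by (rule eventually_mono) simp
  qed simp
  have off_dead: "\<forall>\<^sub>F y in at (x, \<zeta>). dead < \<bar>k * \<zeta>\<bar> \<longrightarrow> dead < \<bar>k * snd y\<bar>"
  proof (cases "dead < \<bar>k * \<zeta>\<bar>")
    case True
    then have "\<forall>\<^sub>F y in at (x, \<zeta>). dead < \<bar>k * snd y\<bar>"
      by (intro order_tendstoD(1)[where y = "\<bar>k * \<zeta>\<bar>"] tendsto_intros snd_lim)
    then show ?thesis by (rule eventually_mono) simp
  qed simp
  have "(g, \<gamma> * \<zeta>) \<bullet> v \<le> \<Phi> (x, \<zeta>)"
  proof (rule krasowskii_halfspace[OF v])
    fix e :: real assume "e > 0"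
    with \<Phi>_lim have "\<forall>\<^sub>F y in at (x, \<zeta>). \<Phi> y < \<Phi> (x, \<zeta>) + e"
      by (intro order_tendstoD(2)) auto
    with in_range same_sign off_dead
    show "\<forall>\<^sub>F y in at (x, \<zeta>). (g, \<gamma> * \<zeta>) \<bullet> ?h y \<le> \<Phi> (x, \<zeta>) + e"
    proof eventually_elim
      case (elim y)
      then show ?case using pointwise[of y] by linarith
    qed
  next
    show "(g, \<gamma> * \<zeta>) \<bullet> ?h (x, \<zeta>) \<le> \<Phi> (x, \<zeta>)"
      using range by (intro pointwise) (auto simp: zero_less_mult_iff linorder_neq_iff)
  qed
  then show ?thesis
    by (simp add: \<Phi>_def \<kappa>_def dead_def power2_eq_square mult.assoc split: if_splits)
qed

section \<open>Practical stability\<close>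

theorem proposition1:
  fixes P :: "'p::topological_space set"
    and F G :: "real^'n \<Rightarrow> 'p \<Rightarrow> real^'n"
    and q b :: "real^'n \<Rightarrow> real \<Rightarrow> 'p \<Rightarrow> real"
    and A :: "(real^'n) set"
    and V :: "real^'n \<Rightarrow> real"
    and b0 c d \<sigma> \<delta> :: real
  assumes "compact P"
    and "continuous_on (UNIV \<times> P) (\<lambda>(x, \<mu>). F x \<mu>)"
    and "continuous_on (UNIV \<times> P) (\<lambda>(x, \<mu>). G x \<mu>)"
    and "continuous_on (UNIV \<times> UNIV \<times> P) (\<lambda>(x, \<zeta>, \<mu>). q x \<zeta> \<mu>)"
    and "continuous_on (UNIV \<times> UNIV \<times> P) (\<lambda>(x, \<zeta>, \<mu>). b x \<zeta> \<mu>)"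
    and "0 < b0" "\<And>x \<zeta> \<mu>. \<mu> \<in> P \<Longrightarrow> b0 \<le> b x \<zeta> \<mu>"
    and "uniform_lyapunov F P A c V"
    and "1 \<le> d"
    and W_proper: "\<And>l. 0 < l \<Longrightarrow> compact (Omega A V c d l)"
    and "0 < \<sigma>"
    and "0 < \<delta>" "\<delta> < 1"
  shows "\<exists>kstar::real. \<exists>jstar::nat. \<exists>u0 :: real \<Rightarrow> real.
    0 < kstar \<and> 0 < jstar \<and> (\<forall>k\<ge>kstar. 0 < u0 k) \<and>
    (\<forall>k\<ge>kstar. \<forall>j\<ge>jstar. \<forall>\<Psi>. log_quantizer (u0 k) j \<delta> \<Psi> \<longrightarrow>
      (\<forall>\<mu>\<in>P. \<forall>\<phi>. krasowskii_solution (\<lambda>t. closed_loop F G q b \<mu> \<Psi> k) \<phi> \<longrightarrow>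
        \<phi> 0 \<in> Omega A V c d (c\<^sup>2 + d\<^sup>2 + 1) \<longrightarrow>
          (\<forall>t\<ge>0. \<bar>k * snd (\<phi> t)\<bar> \<le> u0 k / (1 - \<delta>)) \<and>
          (\<exists>T>0. \<forall>t\<ge>T. \<phi> t \<in> Omega A V c d \<sigma>)))"
proof -
  note F_cont = assms(2) and G_cont = assms(3) and q_cont = assms(4)
  note b0 = assms(6,7) and d = assms(9) and \<delta> = assms(12,13)
  obtain DV where A: "open A" and c: "1 \<le> c" and V0: "V 0 = 0"
    and DV: "\<And>x. x \<in> A \<Longrightarrow> (V has_derivative (\<lambda>h. DV x \<bullet> h)) (at x)" and DV_cont: "continuous_on A DV"
    and V_decay: "\<And>x \<mu>. x \<in> A \<Longrightarrow> V x \<le> c + 1 \<Longrightarrow> x \<noteq> 0 \<Longrightarrow> \<mu> \<in> P \<Longrightarrow> DV x \<bullet> F x \<mu> < 0"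
    using assms(8) unfolding uniform_lyapunov_def by blast
  let ?U = "W_dom A V c d" and ?W = "W V c d" and ?g = "W_grad DV V c d"
  define L where "L = c\<^sup>2 + d\<^sup>2 + 1"
  define s where "s = min \<sigma> L"
  have L: "0 < L" by (simp add: L_def add_nonneg_pos)
  have s: "0 < s" "s \<le> L" "s \<le> \<sigma>" using L \<open>0 < \<sigma>\<close> by (auto simp: s_def)

  have V_cont: "continuous_on A V"
    by (rule has_derivative_continuous_on) (rule has_derivative_at_withinI[OF DV])
  have U_open: "open ?U"
  proof -
    have "{x \<in> A. V x < c + 1} = A \<inter> V -` {..<c + 1}" by auto
    then have "open {x \<in> A. V x < c + 1}"
      using continuous_open_preimage[OF V_cont A, of "{..<c + 1}"] by simp
    moreover have "open {\<zeta>::real. \<zeta>\<^sup>2 < d + 1}" by (intro open_Collect_less continuous_intros)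
    ultimately show ?thesis unfolding W_dom_def by (rule open_Times)
  qed
  have fst_U: "fst y \<in> A" if "y \<in> ?U" for y using that by (auto simp: W_dom_def)
  have W_deriv: "(?W has_derivative (\<lambda>h. ?g y \<bullet> h)) (at y)" if "y \<in> ?U" for y
    using DV[OF fst_U[OF that]] that by (rule W_has_derivative)
  have W_cont: "continuous_on ?U ?W"
    by (rule has_derivative_continuous_on) (rule has_derivative_at_withinI[OF W_deriv])
  have V_fst_cont: "continuous_on ?U (\<lambda>y. V (fst y))"
    using fst_U by (intro continuous_on_compose2[OF V_cont] continuous_intros) auto
  have DV_fst_cont: "continuous_on ?U (\<lambda>y. DV (fst y))"
    using fst_U by (intro continuous_on_compose2[OF DV_cont] continuous_intros) auto
  have g_cont: "continuous_on ?U ?g"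
    unfolding W_grad_def[abs_def]
    by (intro continuous_intros V_fst_cont DV_fst_cont) (auto simp: W_dom_def)
  have U_snd: "\<bar>snd y\<bar> < d + 1" if "y \<in> ?U" for y
  proof -
    have "(snd y)\<^sup>2 < d + 1" using that by (auto simp: W_dom_def)
    also have "\<dots> \<le> (d + 1)\<^sup>2" using d by (simp add: power2_eq_square)
    finally have "\<bar>snd y\<bar>\<^sup>2 < (d + 1)\<^sup>2" by simp
    then show ?thesis by (rule power2_less_imp_less) (use d in simp)
  qed

  \<comment> \<open>The upper level \<open>L + 1\<close> leaves room for a solution that would try to leave \<open>\<Omega>\<^sub>L\<close>.\<close>
  define S where "S = {y \<in> Omega A V c d (L + 1). s \<le> ?W y}"
  have S_U: "S \<subseteq> ?U" by (auto simp: S_def Omega_def)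
  have "compact S"
  proof -
    have "continuous_on (Omega A V c d (L + 1)) ?W"
      using W_cont by (rule continuous_on_subset) (auto simp: Omega_def)
    from closedin_compact[OF W_proper continuous_closedin_preimage[OF this, of "{s..}"]] L
    have "compact (Omega A V c d (L + 1) \<inter> ?W -` {s..})" by simp
    also have "Omega A V c d (L + 1) \<inter> ?W -` {s..} = S" by (auto simp: S_def)
    finally show ?thesis .
  qed
  \<comment> \<open>The derivative of \<open>W\<close> along the open-loop field, as a function of \<open>((x, \<zeta>), \<mu>)\<close>.\<close>
  define a where "a p = fst (?g (fst p)) \<bullet> (F (fst (fst p)) (snd p) + snd (fst p) *\<^sub>R G (fst (fst p)) (snd p)) +
    snd (?g (fst p)) * q (fst (fst p)) (snd (fst p)) (snd p)" for p
  have a_cont: "continuous_on (S \<times> P) a"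
  proof -
    have arg_cont: "continuous_on (S \<times> P) (\<lambda>p. (fst (fst p), snd p))"
      "continuous_on (S \<times> P) (\<lambda>p. (fst (fst p), snd (fst p), snd p))"
      by (intro continuous_intros)+
    have arg_mem: "(\<lambda>p. (fst (fst p), snd p)) ` (S \<times> P) \<subseteq> UNIV \<times> P"
      "(\<lambda>p. (fst (fst p), snd (fst p), snd p)) ` (S \<times> P) \<subseteq> UNIV \<times> UNIV \<times> P" by auto
    have "continuous_on (S \<times> P) (\<lambda>p. ?g (fst p))"
      using S_U by (intro continuous_on_compose2[OF g_cont] continuous_intros) auto
    moreover have "continuous_on (S \<times> P) (\<lambda>p. F (fst (fst p)) (snd p))"
      using continuous_on_compose2[OF F_cont arg_cont(1) arg_mem(1)] by simp
    moreover have "continuous_on (S \<times> P) (\<lambda>p. G (fst (fst p)) (snd p))"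
      using continuous_on_compose2[OF G_cont arg_cont(1) arg_mem(1)] by simp
    moreover have "continuous_on (S \<times> P) (\<lambda>p. q (fst (fst p)) (snd (fst p)) (snd p))"
      using continuous_on_compose2[OF q_cont arg_cont(2) arg_mem(2)] by simp
    ultimately show ?thesis unfolding a_def[abs_def] by (intro continuous_intros)
  qed
  \<comment> \<open>For \<open>\<zeta> = 0\<close> only a positive multiple of \<open>DV x \<bullet> F x \<mu>\<close> survives, and \<open>x \<noteq> 0\<close>
    because \<open>W\<close> is positive on \<open>S\<close>.\<close>
  have a_neg: "a p < 0" if p: "p \<in> S \<times> P" and zero: "(snd (fst p))\<^sup>2 = 0" for p
  proof -
    obtain x \<mu> where p_eq: "p = ((x, 0), \<mu>)" using zero by (cases p) auto
    have x: "(x, 0) \<in> S" "x \<in> A" "V x < c + 1" and \<mu>: "\<mu> \<in> P"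
      using p S_U by (auto simp: p_eq W_dom_def)
    have "x \<noteq> 0" using x(1) V0 s(1) by (auto simp: S_def W_def)
    then have "DV x \<bullet> F x \<mu> < 0" using V_decay x \<mu> by simp
    moreover have "0 < c * (c + 1) / (c + 1 - V x)\<^sup>2" using c x(3) by simp
    ultimately have "c * (c + 1) / (c + 1 - V x)\<^sup>2 * (DV x \<bullet> F x \<mu>) < 0" by (intro mult_pos_neg)
    then show ?thesis by (simp add: a_def p_eq W_grad_def)
  qed
  have SP: "compact (S \<times> P)" using \<open>compact S\<close> assms(1) by (rule compact_Times)
  have square_cont: "continuous_on (S \<times> P) (\<lambda>p. (snd (fst p))\<^sup>2)" by (intro continuous_intros)
  obtain K \<epsilon> where K: "0 < K" and \<epsilon>: "0 < \<epsilon>"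
    and K_bound: "\<And>p. p \<in> S \<times> P \<Longrightarrow> a p - K * (snd (fst p))\<^sup>2 \<le> - \<epsilon>"
    by (rule penalty_uniformly_negative[OF SP a_cont square_cont zero_le_power2 a_neg]; blast)

  \<comment> \<open>For these gains the quantized feedback supplies the penalty \<open>K * \<zeta>\<^sup>2\<close> outside the dead zone.\<close>
  define kstar where "kstar = K / (b0 * (1 - \<delta>))"
  have kstar: "0 < kstar" using K b0(1) \<delta> by (simp add: kstar_def)
  \<comment> \<open>In a dead zone of half-width \<open>\<eta>\<close> the missing penalty costs only half of the margin \<open>\<epsilon>\<close>.\<close>
  define \<eta> where "\<eta> = min 1 (\<epsilon> / (2 * K))"
  have \<eta>: "0 < \<eta>" "K * \<eta>\<^sup>2 \<le> \<epsilon> / 2"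
  proof -
    show "0 < \<eta>" using K \<epsilon> by (simp add: \<eta>_def)
    moreover have "\<eta> \<le> 1" by (simp add: \<eta>_def)
    ultimately have "\<eta>\<^sup>2 \<le> \<eta>" by (simp add: power2_eq_square mult_left_le)
    also have "\<dots> \<le> \<epsilon> / (2 * K)" by (simp add: \<eta>_def)
    finally show "K * \<eta>\<^sup>2 \<le> \<epsilon> / 2" using K by (simp add: field_simps)
  qed
  define \<rho> where "\<rho> = (1 - \<delta>) / (1 + \<delta>)"
  have \<rho>: "0 < \<rho>" "\<rho> < 1" using \<delta> by (auto simp: \<rho>_def)
  have "0 < \<eta> / (d + 1)" using \<eta> d by simp
  then obtain J where J: "\<rho> ^ J < \<eta> / (d + 1)"
    using real_arch_pow_inv \<rho>(2) by blast
  \<comment> \<open>On the domain of \<open>W\<close> one has \<open>\<zeta>\<^sup>2 < d + 1 \<le> (d + 1)\<^sup>2\<close>. Scaling the range of the quantizer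
    with the gain fixes this range, and the dead zone, in terms of \<open>\<zeta>\<close>: the half-width
    \<open>\<rho> ^ j * (d + 1) / (1 + \<delta>)\<close> of the dead zone does not depend on \<open>k\<close>.\<close>
  define u0 where "u0 k = k * (d + 1)" for k :: real

  have closed_loop: "(\<forall>t\<ge>0. \<bar>k * snd (\<phi> t)\<bar> \<le> u0 k / (1 - \<delta>)) \<and> (\<exists>T>0. \<forall>t\<ge>T. \<phi> t \<in> Omega A V c d \<sigma>)"
    if k: "kstar \<le> k" and j: "Suc J \<le> j" and \<Psi>: "log_quantizer (u0 k) j \<delta> \<Psi>" and \<mu>: "\<mu> \<in> P"
      and sol: "krasowskii_solution (\<lambda>t. closed_loop F G q b \<mu> \<Psi> k) \<phi>"
      and init: "\<phi> 0 \<in> Omega A V c d (c\<^sup>2 + d\<^sup>2 + 1)" for k j \<Psi> \<mu> \<phi>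
  proof -
    have k0: "0 < k" using k kstar by simp
    have u0: "0 < u0 k" using k0 d by (simp add: u0_def)
    have range: "\<bar>k * snd y\<bar> < u0 k / (1 - \<delta>)" if "y \<in> ?U" for y
    proof -
      have "\<bar>k * snd y\<bar> < u0 k" using U_snd[OF that] k0 by (simp add: u0_def abs_mult)
      also have "\<dots> \<le> u0 k / (1 - \<delta>)" using u0 \<delta> by (simp add: pos_le_divide_eq mult_left_le)
      finally show ?thesis .
    qed
    have arg_cont: "continuous_on UNIV (\<lambda>x::real^'n. (x, \<mu>))"
      "continuous_on UNIV (\<lambda>y::(real^'n) \<times> real. (fst y, snd y, \<mu>))"
      by (intro continuous_intros)+
    have arg_mem: "range (\<lambda>x::real^'n. (x, \<mu>)) \<subseteq> UNIV \<times> P"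
      "range (\<lambda>y::(real^'n) \<times> real. (fst y, snd y, \<mu>)) \<subseteq> UNIV \<times> UNIV \<times> P" using \<mu> by auto
    have F_cont': "isCont (\<lambda>x. F x \<mu>) x" for x
      using continuous_on_compose2[OF F_cont arg_cont(1) arg_mem(1)] by (simp add: continuous_on_eq_continuous_at)
    have G_cont': "isCont (\<lambda>x. G x \<mu>) x" for x
      using continuous_on_compose2[OF G_cont arg_cont(1) arg_mem(1)] by (simp add: continuous_on_eq_continuous_at)
    have q_cont': "isCont (\<lambda>y. q (fst y) (snd y) \<mu>) y" for y
      using continuous_on_compose2[OF q_cont arg_cont(2) arg_mem(2)] by (cases y) (simp add: continuous_on_eq_continuous_at)
    have decay: "?g y \<bullet> v \<le> - (\<epsilon> / 2)"
      if y: "y \<in> ?U" "s \<le> ?W y" "?W y \<le> L + 1" and v: "v \<in> krasowskii (closed_loop F G q b \<mu> \<Psi> k) y" for y v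
    proof -
      obtain x \<zeta> where y_eq: "y = (x, \<zeta>)" by (cases y)
      define \<gamma> where "\<gamma> = 2 * d * (d + 1) / (d + 1 - \<zeta>\<^sup>2)\<^sup>2"
      have g_eq: "?g y = (fst (?g y), \<gamma> * \<zeta>)" by (simp add: y_eq W_grad_def \<gamma>_def)
      have \<gamma>: "1 \<le> \<gamma>"
      proof -
        have z: "0 < d + 1 - \<zeta>\<^sup>2" "d + 1 - \<zeta>\<^sup>2 \<le> d + 1" using y(1) by (auto simp: y_eq W_dom_def)
        then have "(d + 1 - \<zeta>\<^sup>2)\<^sup>2 \<le> (d + 1)\<^sup>2" by (intro power_mono) auto
        also have "\<dots> \<le> 2 * d * (d + 1)" using d by (simp add: power2_eq_square)
        finally show ?thesis using z by (simp add: \<gamma>_def)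
      qed
      let ?pen = "if qlevel (u0 k) \<delta> j / (1 + \<delta>) < \<bar>k * \<zeta>\<bar> then \<gamma> * b0 * (1 - \<delta>) * k * \<zeta>\<^sup>2 else 0"
      have "?g y \<bullet> v \<le> a (y, \<mu>) - ?pen"
      proof -
        have "(fst (?g y), \<gamma> * \<zeta>) \<bullet> v \<le> fst (?g y) \<bullet> (F x \<mu> + \<zeta> *\<^sub>R G x \<mu>) + \<gamma> * \<zeta> * q x \<zeta> \<mu> - ?pen"
        proof (rule krasowskii_closed_loop_estimate[where F = F and G = G and q = q and b = b and \<mu> = \<mu>])
          show "\<bar>k * \<zeta>\<bar> < u0 k / (1 - \<delta>)" using range[OF y(1)] by (simp add: y_eq)
          show "v \<in> krasowskii (closed_loop F G q b \<mu> \<Psi> k) (x, \<zeta>)" using v by (simp add: y_eq)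
          show "0 \<le> \<gamma>" using \<gamma> by simp
        qed (use \<delta> u0 k0 \<Psi> F_cont' G_cont' q_cont' b0 \<mu> in auto)
        moreover have "snd (?g y) = \<gamma> * \<zeta>" using g_eq by (metis snd_conv)
        ultimately show ?thesis unfolding a_def using g_eq by (simp add: y_eq)
      qed
      moreover have "a (y, \<mu>) - K * \<zeta>\<^sup>2 \<le> - \<epsilon>"
        using K_bound[of "(y, \<mu>)"] y \<mu> by (simp add: S_def Omega_def y_eq)
      moreover have "K * \<zeta>\<^sup>2 \<le> ?pen + \<epsilon> / 2"
      proof (cases "qlevel (u0 k) \<delta> j / (1 + \<delta>) < \<bar>k * \<zeta>\<bar>")
        case True
        have pos: "0 < b0 * (1 - \<delta>)" using b0(1) \<delta> by simp
        then have "K \<le> b0 * (1 - \<delta>) * k" using k by (simp add: kstar_def pos_divide_le_eq mult.commute)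
        also have "\<dots> \<le> \<gamma> * (b0 * (1 - \<delta>) * k)"
          using mult_right_mono[OF \<gamma>, of "b0 * (1 - \<delta>) * k"] mult_pos_pos[OF pos k0] by linarith
        finally have "K * \<zeta>\<^sup>2 \<le> \<gamma> * (b0 * (1 - \<delta>) * k) * \<zeta>\<^sup>2" by (rule mult_right_mono) simp
        then show ?thesis using True \<epsilon> by (simp add: mult.assoc)
      next
        case False
        have "k * \<bar>\<zeta>\<bar> \<le> \<rho> ^ j * (k * (d + 1)) / (1 + \<delta>)"
          using False k0 by (simp add: qlevel_def \<rho>_def u0_def abs_mult)
        also have "\<dots> \<le> \<rho> ^ j * (k * (d + 1)) / 1"
          using \<rho> k0 d \<delta> by (intro divide_left_mono) auto
        also have "\<dots> = k * (\<rho> ^ j * (d + 1))" by simp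
        finally have "\<bar>\<zeta>\<bar> \<le> \<rho> ^ j * (d + 1)" using k0 by simp
        also have "\<dots> \<le> \<rho> ^ J * (d + 1)"
          using \<rho> j d by (intro mult_right_mono power_decreasing) auto
        also have "\<dots> \<le> \<eta>" using J d by (simp add: pos_less_divide_eq)
        finally have "\<zeta>\<^sup>2 \<le> \<eta>\<^sup>2" using \<eta>(1) by (simp add: abs_le_square_iff[symmetric])
        then have "K * \<zeta>\<^sup>2 \<le> K * \<eta>\<^sup>2" using K by simp
        then show ?thesis using False \<eta>(2) by simp
      qed
      ultimately show ?thesis by linarith
    qed
    have proper: "compact {y \<in> ?U. ?W y \<le> l}" if "0 < l" for l
      using W_proper[OF that] by (simp add: Omega_def)
    have start: "\<phi> 0 \<in> ?U" "?W (\<phi> 0) \<le> L" using init by (auto simp: Omega_def L_def)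
    have stay: "\<phi> t \<in> ?U \<and> ?W (\<phi> t) \<le> L" if "0 \<le> t" for t
      by (rule krasowskii_sublevel_attracts(1)[OF U_open W_deriv g_cont proper s(1,2)
            half_gt_zero[OF \<epsilon>] decay sol start that])
    have "\<exists>T>0. \<forall>t\<ge>T. \<phi> t \<in> ?U \<and> ?W (\<phi> t) \<le> s"
      by (rule krasowskii_sublevel_attracts(2)[OF U_open W_deriv g_cont proper s(1,2)
            half_gt_zero[OF \<epsilon>] decay sol start])
    then have "\<exists>T>0. \<forall>t\<ge>T. \<phi> t \<in> Omega A V c d \<sigma>"
      using s(3) by (fastforce simp: Omega_def)
    moreover have "\<bar>k * snd (\<phi> t)\<bar> \<le> u0 k / (1 - \<delta>)" if "0 \<le> t" for t
      using range stay[OF that] by (simp add: less_imp_le)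
    ultimately show ?thesis by blast
  qed
  have "\<forall>k\<ge>kstar. 0 < u0 k" using kstar d by (simp add: u0_def)
  then show ?thesis
    using kstar closed_loop by (intro exI[of _ kstar] exI[of _ "Suc J"] exI[of _ u0]) blast
qed

end
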